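(* Let $S$ be a left cancellative left amenable semigroup with unit. Then $S^*$ is an amenable inverse semigroup.
   Context: $S^*$ is the inverse semigroup generated by elements $v_p$ ($p\in S$) subject to $v_pv_q=v_{pq}$ and $v_p^*v_p=1$ (quotient of the free inverse semigroup on $\{v_p:p\in S\}$ by the congruence generated by these relations). A semigroup $P$ is left amenable if there is a mean $m$ on $\ell^\infty(P)$ with $m(\phi t)=m(\phi)$ for all $t\in P$, $\phi\in\ell^\infty(P)$, where $(\phi t)(x)=\phi(tx)$. For inverse semigroups left, right and two-sided amenability are equivalent, and one says "amenable". *)

theory Defs
  imports "HOL-Analysis.Analysis"
begin

section \<open>Means and amenability\<close>

text \<open>The Banach space \<open>\<ell>\<^sup>\<infinity>(P)\<close> of bounded complex functions on \<open>P\<close> is kept as a set of functions;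
  a functional on it is a function on all of \<^typ>\<open>'a \<Rightarrow> complex\<close> whose values outside
  \<open>linf\<close> are irrelevant.\<close>

definition linf :: "('a \<Rightarrow> complex) set" where
  "linf = {\<phi>. bounded (range \<phi>)}"

text \<open>A mean is a linear functional \<open>m\<close> with \<open>\<parallel>m\<parallel> = m(1) = 1\<close>. The last two conditions say exactly this,
  since \<open>m(1) = 1\<close> forces \<open>\<parallel>m\<parallel> \<ge> 1\<close>.\<close>

definition mean :: "(('a \<Rightarrow> complex) \<Rightarrow> complex) \<Rightarrow> bool" where
  "mean m \<longleftrightarrow>
     (\<forall>\<phi>\<in>linf. \<forall>\<psi>\<in>linf. m (\<lambda>x. \<phi> x + \<psi> x) = m \<phi> + m \<psi>) \<and>
     (\<forall>c. \<forall>\<phi>\<in>linf. m (\<lambda>x. c * \<phi> x) = c * m \<phi>) \<and>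
     (\<forall>\<phi>\<in>linf. norm (m \<phi>) \<le> (SUP x. norm (\<phi> x))) \<and>
     m (\<lambda>_. 1) = 1"

definition left_invariant ::
    "('a \<Rightarrow> 'a \<Rightarrow> 'a) \<Rightarrow> (('a \<Rightarrow> complex) \<Rightarrow> complex) \<Rightarrow> bool" where
  "left_invariant f m \<longleftrightarrow> (\<forall>t. \<forall>\<phi>\<in>linf. m (\<lambda>x. \<phi> (f t x)) = m \<phi>)"

definition right_invariant ::
    "('a \<Rightarrow> 'a \<Rightarrow> 'a) \<Rightarrow> (('a \<Rightarrow> complex) \<Rightarrow> complex) \<Rightarrow> bool" where
  "right_invariant f m \<longleftrightarrow> (\<forall>t. \<forall>\<phi>\<in>linf. m (\<lambda>x. \<phi> (f x t)) = m \<phi>)"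

definition left_amenable :: "('a \<Rightarrow> 'a \<Rightarrow> 'a) \<Rightarrow> bool" where
  "left_amenable f \<longleftrightarrow> (\<exists>m. mean m \<and> left_invariant f m)"

text \<open>Two-sided amenability; it implies left and right amenability, and for inverse semigroups
  the three notions coincide.\<close>

definition amenable :: "('a \<Rightarrow> 'a \<Rightarrow> 'a) \<Rightarrow> bool" where
  "amenable f \<longleftrightarrow> (\<exists>m. mean m \<and> left_invariant f m \<and> right_invariant f m)"


section \<open>Inverse semigroups\<close>

locale inverse_semigroup = semigroup f for f :: "'a \<Rightarrow> 'a \<Rightarrow> 'a" +
  assumes ex1_inverse: "\<exists>!y. f (f x y) x = x \<and> f (f y x) y = y"


subsection \<open>The free inverse semigroup\<close>

text \<open>Inverse semigroups form a variety of algebras with a binary and a unary operation. The free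
  inverse semigroup on a set of generators is the algebra of formal terms modulo
  the identities that define the variety.\<close>

datatype 'a inv_term = Gen 'a | Mul "'a inv_term" "'a inv_term" | Star "'a inv_term"

inductive inv_eq :: "'a inv_term \<Rightarrow> 'a inv_term \<Rightarrow> bool" where
  refl: "inv_eq x x"
| sym: "inv_eq x y \<Longrightarrow> inv_eq y x"
| trans: "inv_eq x y \<Longrightarrow> inv_eq y z \<Longrightarrow> inv_eq x z"
| mul: "inv_eq x x' \<Longrightarrow> inv_eq y y' \<Longrightarrow> inv_eq (Mul x y) (Mul x' y')"
| star: "inv_eq x x' \<Longrightarrow> inv_eq (Star x) (Star x')"
| assoc: "inv_eq (Mul (Mul x y) z) (Mul x (Mul y z))"
| star_star: "inv_eq (Star (Star x)) x"
| star_mul: "inv_eq (Star (Mul x y)) (Mul (Star y) (Star x))"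
| regular: "inv_eq (Mul (Mul x (Star x)) x) x"
| commute: "inv_eq (Mul (Mul x (Star x)) (Mul y (Star y))) (Mul (Mul y (Star y)) (Mul x (Star x)))"

quotient_type 'a free_inv = "'a inv_term" / inv_eq
  by (intro equivpI reflpI sympI transpI) (blast intro: inv_eq.intros)+

instantiation free_inv :: (type) semigroup_mult
begin

lift_definition times_free_inv :: "'a free_inv \<Rightarrow> 'a free_inv \<Rightarrow> 'a free_inv" is Mul
  by (rule inv_eq.mul)

instance
  by standard (transfer, rule inv_eq.assoc)

end

lift_definition gen :: "'a \<Rightarrow> 'a free_inv" is Gen .

lift_definition star :: "'a free_inv \<Rightarrow> 'a free_inv" is Star
  by (rule inv_eq.star)


subsection \<open>The inverse semigroup \<open>S\<^sup>*\<close> of a monoid \<open>S\<close>\<close>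

inductive generated_congruence ::
    "('b \<Rightarrow> 'b \<Rightarrow> bool) \<Rightarrow> 'b::semigroup_mult \<Rightarrow> 'b \<Rightarrow> bool" for R where
  base: "R x y \<Longrightarrow> generated_congruence R x y"
| refl: "generated_congruence R x x"
| sym: "generated_congruence R x y \<Longrightarrow> generated_congruence R y x"
| trans: "generated_congruence R x y \<Longrightarrow> generated_congruence R y z \<Longrightarrow> generated_congruence R x z"
| mult: "generated_congruence R x x' \<Longrightarrow> generated_congruence R y y' \<Longrightarrow>
    generated_congruence R (x * y) (x' * y')"

text \<open>The free inverse semigroup has no identity element. The relation \<open>v\<^sub>p\<^sup>*v\<^sub>p = 1\<close>, in which \<open>1\<close> is the
  identity of \<open>S\<^sup>*\<close>, is therefore imposed as the two unit laws for \<open>v\<^sub>p\<^sup>*v\<^sub>p\<close>.\<close>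

inductive univ_inv_rel :: "'a::monoid_mult free_inv \<Rightarrow> 'a free_inv \<Rightarrow> bool" where
  gen_mult: "univ_inv_rel (gen p * gen q) (gen (p * q))"
| unit_left: "univ_inv_rel (star (gen p) * gen p * x) x"
| unit_right: "univ_inv_rel (x * (star (gen p) * gen p)) x"

quotient_type (overloaded) 'a univ_inv =
    "'a::monoid_mult free_inv" / "generated_congruence univ_inv_rel"
  by (intro equivpI reflpI sympI transpI) (blast intro: generated_congruence.intros)+

text \<open>The identity of \<open>S\<^sup>*\<close> is \<open>v\<^sub>1\<close>, which is a consequence of the relations.\<close>

lemma gen_one_cong:
  "generated_congruence univ_inv_rel (gen (1::'a::monoid_mult)) (star (gen 1) * gen 1)"
proof -
  have "generated_congruence univ_inv_rel (star (gen (1::'a)) * gen 1 * gen 1) (gen 1)"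
    by (intro generated_congruence.base univ_inv_rel.unit_left)
  moreover have "generated_congruence univ_inv_rel
      (star (gen (1::'a)) * (gen 1 * gen 1)) (star (gen 1) * gen (1 * 1))"
    by (intro generated_congruence.mult generated_congruence.refl
        generated_congruence.base univ_inv_rel.gen_mult)
  ultimately show ?thesis
    by (auto simp: mult.assoc intro: generated_congruence.sym generated_congruence.trans)
qed

instantiation univ_inv :: (monoid_mult) monoid_mult
begin

lift_definition times_univ_inv :: "'a univ_inv \<Rightarrow> 'a univ_inv \<Rightarrow> 'a univ_inv" is "(*)"
  by (rule generated_congruence.mult)

lift_definition one_univ_inv :: "'a univ_inv" is "gen 1" .

instance
proof
  fix a b c :: "'a univ_inv"
  show "a * b * c = a * (b * c)"
    by transfer (simp add: mult.assoc generated_congruence.refl)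
  show "1 * a = a"
    by transfer (meson gen_one_cong generated_congruence.intros univ_inv_rel.unit_left)
  show "a * 1 = a"
    by transfer (meson gen_one_cong generated_congruence.intros univ_inv_rel.unit_right)
qed

end

end

theory Submission
  imports Defs
begin

text \<open>A left invariant mean on \<open>S\<close>, pushed forward along \<open>p \<mapsto> v\<^sub>p\<close>, is a mean on \<open>S\<^sup>*\<close> invariant under left
  translation by every \<open>v\<^sub>t\<close>. Since \<open>v\<^sub>t\<^sup>*v\<^sub>t = 1\<close>, it is then also invariant under \<open>v\<^sub>t\<^sup>*\<close>:
  for \<open>\<psi>(x) = \<phi>(v\<^sub>t\<^sup>*x)\<close> one has \<open>m(\<psi>) = m(x \<mapsto> \<psi>(v\<^sub>tx)) = m(\<phi>)\<close>. As \<open>S\<^sup>*\<close> is generated by the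
  \<open>v\<^sub>t\<close> and \<open>v\<^sub>t\<^sup>*\<close>, the mean is left invariant. Pushing forward along \<open>p \<mapsto> v\<^sub>p\<^sup>*\<close> gives a right invariant mean
  in the same way, and the two are combined into a two-sided one.
  That \<open>S\<^sup>*\<close> is an inverse semigroup follows from Lallement's lemma: idempotents of a
  quotient of a regular semigroup lift to idempotents.\<close>

section \<open>Means\<close>

lemma linf_comp:
  assumes "\<phi> \<in> linf" shows "(\<lambda>x. \<phi> (h x)) \<in> linf"
  using assms unfolding linf_def mem_Collect_eq
  by (rule bounded_subset) auto

lemma norm_mean_le:
  assumes m: "mean m" and \<phi>: "\<phi> \<in> linf" and B: "\<And>x. norm (\<phi> x) \<le> B"
  shows "norm (m \<phi>) \<le> B"
proof -
  have "norm (m \<phi>) \<le> (SUP x. norm (\<phi> x))"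
    using m \<phi> unfolding mean_def by blast
  also have "\<dots> \<le> B"
    by (rule cSUP_least) (use B in auto)
  finally show ?thesis .
qed

lemma linf_norm_le_SUP:
  assumes "\<phi> \<in> linf" shows "norm (\<phi> x) \<le> (SUP x. norm (\<phi> x))"
proof (rule cSUP_upper)
  show "bdd_above (range (\<lambda>x. norm (\<phi> x)))"
    using assms unfolding linf_def bounded_iff bdd_above_def by auto
qed simp

lemma linf_if_bounded: "(\<And>x. norm (\<phi> x) \<le> B) \<Longrightarrow> \<phi> \<in> linf"
  unfolding linf_def bounded_iff by auto

lemma mean_pushforward:
  fixes h :: "'a \<Rightarrow> 'b"
  assumes m: "mean m" shows "mean (\<lambda>\<phi>. m (\<lambda>x. \<phi> (h x)))"
  unfolding mean_def
proof (intro conjI ballI allI)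
  fix \<phi> :: "'b \<Rightarrow> complex" assume \<phi>: "\<phi> \<in> linf"
  show "norm (m (\<lambda>x. \<phi> (h x))) \<le> (SUP x. norm (\<phi> x))"
    by (rule norm_mean_le[OF m linf_comp[OF \<phi>] linf_norm_le_SUP[OF \<phi>]])
qed (use m in \<open>simp_all add: mean_def linf_comp\<close>)

lemma mean_convolution_linf:
  assumes l: "mean l" and \<phi>: "\<phi> \<in> linf"
  shows "(\<lambda>y. l (\<lambda>x. \<phi> (f x y))) \<in> linf"
  by (rule linf_if_bounded, rule norm_mean_le[OF l linf_comp[OF \<phi>] linf_norm_le_SUP[OF \<phi>]])

text \<open>This functional is the convolution of \<open>l\<close> and \<open>r\<close> along
  \<open>f\<close>, used below to merge a left and a right invariant mean.\<close>

lemma mean_convolution: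
  fixes f :: "'a \<Rightarrow> 'b \<Rightarrow> 'c"
  assumes l: "mean l" and r: "mean r"
  shows "mean (\<lambda>\<phi>. r (\<lambda>y. l (\<lambda>x. \<phi> (f x y))))"
  unfolding mean_def
proof (intro conjI ballI allI)
  note conv = mean_convolution_linf[OF l]
  fix \<phi> :: "'c \<Rightarrow> complex" assume \<phi>: "\<phi> \<in> linf"
  show "norm (r (\<lambda>y. l (\<lambda>x. \<phi> (f x y)))) \<le> (SUP x. norm (\<phi> x))"
    by (rule norm_mean_le[OF r conv[OF \<phi>]],
        rule norm_mean_le[OF l linf_comp[OF \<phi>] linf_norm_le_SUP[OF \<phi>]])
  show "r (\<lambda>y. l (\<lambda>x. c * \<phi> (f x y))) = c * r (\<lambda>y. l (\<lambda>x. \<phi> (f x y)))" for c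
    using l r conv[OF \<phi>, of f] by (simp add: mean_def linf_comp[OF \<phi>])
  fix \<psi> :: "'c \<Rightarrow> complex" assume \<psi>: "\<psi> \<in> linf"
  show "r (\<lambda>y. l (\<lambda>x. \<phi> (f x y) + \<psi> (f x y)))
      = r (\<lambda>y. l (\<lambda>x. \<phi> (f x y))) + r (\<lambda>y. l (\<lambda>x. \<psi> (f x y)))"
    using l r conv[OF \<phi>, of f] conv[OF \<psi>, of f]
    by (simp add: mean_def linf_comp[OF \<phi>] linf_comp[OF \<psi>])
qed (use l r in \<open>simp add: mean_def\<close>)

text \<open>In the convolution a left translation is absorbed by the inner mean \<open>l\<close> for
  each fixed \<open>y\<close>, and a right translation only shifts \<open>y\<close>, where
  \<open>r\<close> absorbs it.\<close>

lemma amenable_if_left_right: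
  assumes "semigroup f"
    and l: "mean l" "left_invariant f l" and r: "mean r" "right_invariant f r"
  shows "amenable f"
proof -
  interpret semigroup f by fact
  let ?m = "\<lambda>\<phi>. r (\<lambda>y. l (\<lambda>x. \<phi> (f x y)))"
  have "left_invariant f ?m"
    unfolding left_invariant_def
  proof (intro allI ballI)
    fix t and \<phi> :: "'a \<Rightarrow> complex" assume \<phi>: "\<phi> \<in> linf"
    have "l (\<lambda>x. \<phi> (f (f t x) y)) = l (\<lambda>x. \<phi> (f x y))" for y
      using l(2) linf_comp[OF \<phi>, of "\<lambda>x. f x y"] by (force simp: left_invariant_def)
    then show "?m (\<lambda>x. \<phi> (f t x)) = ?m \<phi>"
      by (simp add: assoc)
  qed
  moreover have "right_invariant f ?m"
    unfolding right_invariant_def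
  proof (intro allI ballI)
    fix t and \<phi> :: "'a \<Rightarrow> complex" assume \<phi>: "\<phi> \<in> linf"
    have "r (\<lambda>y. l (\<lambda>x. \<phi> (f x (f y t)))) = ?m \<phi>"
      using r(2) mean_convolution_linf[OF l(1) \<phi>, of f] by (force simp: right_invariant_def)
    then show "?m (\<lambda>x. \<phi> (f x t)) = ?m \<phi>"
      by (simp add: assoc)
  qed
  ultimately show ?thesis
    unfolding amenable_def using mean_convolution[OF l(1) r(1)] by blast
qed

section \<open>Inverse semigroups\<close>

lemma (in semigroup) inverse_semigroup_if_idempotents_commute:
  assumes regular: "\<And>x. \<exists>y. f (f x y) x = x \<and> f (f y x) y = y"
    and commute: "\<And>e g. f e e = e \<Longrightarrow> f g g = g \<Longrightarrow> f e g = f g e"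
  shows "inverse_semigroup f"
proof
  fix x
  have idem: "f (f u w) (f u w) = f u w" if "f (f u w) u = u" for u w
    using that by (simp add: assoc[symmetric])
  show "\<exists>!y. f (f x y) x = x \<and> f (f y x) y = y"
  proof (rule ex_ex1I[OF regular])
    fix y z
    assume y: "f (f x y) x = x \<and> f (f y x) y = y" and z: "f (f x z) x = x \<and> f (f z x) z = z"
    \<comment> \<open>Expand the middle \<open>x\<close> of \<open>y x y\<close> as
      \<open>x z x\<close>; then \<open>x z\<close> and \<open>x y\<close> are idempotents and may
      be swapped. The same is done later with \<open>y x\<close> and \<open>z x\<close>.\<close>
    have "y = f y (f (f x z) (f x y))"
      using y z by (metis assoc)
    also have "\<dots> = f y (f (f x y) (f x z))"
      using commute[OF idem idem] y z by metis
    also have "\<dots> = f (f y x) z"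
      using y by (metis assoc)
    also have "\<dots> = f (f (f y x) (f z x)) z"
      using z by (metis assoc)
    also have "\<dots> = f (f (f z x) (f y x)) z"
      using commute[OF idem idem] y z by metis
    also have "\<dots> = z"
      using y z by (metis assoc)
    finally show "y = z" .
  qed
qed


section \<open>Idempotents of the free inverse semigroup\<close>

lemma free_inv_star_star [simp]: "star (star x) = x"
  by transfer (rule inv_eq.star_star)

lemma free_inv_star_mult: "star (x * y) = star y * star x"
  by transfer (rule inv_eq.star_mul)

lemma free_inv_regular: "x * star x * x = x"
  by transfer (rule inv_eq.regular)

lemma free_inv_commute: "(x * star x) * (y * star y) = (y * star y) * (x * star x)"
  by transfer (rule inv_eq.commute)

text \<open>Lets \<open>free_inv_commute\<close> apply to arbitrary idempotents. For idempotent
  \<open>x\<close>, \<open>star x\<close> is a product of the two commuting projections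
  \<open>star x * x\<close> and \<open>x * star x\<close>; in the other order their product is
  \<open>x\<close>, so \<open>star x = x\<close>.\<close>

lemma free_inv_idempotent_eq:
  fixes x :: "'a free_inv"
  assumes "x * x = x" shows "x * star x = x"
proof -
  have star_idem: "star x * star x = star x"
    using assms by (metis free_inv_star_mult)
  have "star x = star x * x * star x"
    using free_inv_regular[of "star x"] by simp
  also have "\<dots> = (star x * x) * (x * star x)"
    using assms by (metis mult.assoc)
  also have "\<dots> = (x * star x) * (star x * x)"
    using free_inv_commute[of x "star x"] by simp
  also have "\<dots> = x * star x * x"
    using star_idem by (metis mult.assoc)
  also have "\<dots> = x"
    by (rule free_inv_regular)
  finally show ?thesis
    using assms by simp
qed

section \<open>The inverse semigroup \<open>S\<^sup>*\<close>\<close>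

lemma abs_univ_inv_mult: "abs_univ_inv (x * y) = abs_univ_inv x * abs_univ_inv y"
  by (simp add: times_univ_inv.abs_eq)

text \<open>The congruence is generated under multiplication only, so \<open>star\<close> is not
  known to descend to the quotient. Lifting idempotents transfers their commutation without
  it.\<close>

lemma univ_inv_idempotent_lift:
  fixes e :: "'a::monoid_mult univ_inv"
  assumes "e * e = e"
  obtains x where "x * x = x" "e = abs_univ_inv x"
proof -
  obtain u where u: "e = abs_univ_inv u"
    by (metis Quotient3_abs_rep Quotient3_univ_inv)
  \<comment> \<open>Idempotent because \<open>star (u * u)\<close> is an inverse of
    \<open>u * u\<close>. In the quotient the outer factors \<open>u\<close> may be replaced by
    \<open>u * u\<close>, and regularity then leaves \<open>e * e = e\<close>.\<close>
  define x where "x = u * star (u * u) * u"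
  have "x * x = u * (star (u * u) * star (star (u * u)) * star (u * u)) * u"
    unfolding x_def by (simp add: mult.assoc)
  also have "\<dots> = x"
    by (simp only: free_inv_regular x_def)
  finally have "x * x = x" .
  moreover have "abs_univ_inv x = e * abs_univ_inv (star (u * u)) * e"
    by (simp add: x_def u abs_univ_inv_mult)
  then have "abs_univ_inv x = abs_univ_inv (u * u * star (u * u) * (u * u))"
    using assms by (simp only: abs_univ_inv_mult flip: u)
  then have "abs_univ_inv x = e"
    using assms by (simp only: free_inv_regular abs_univ_inv_mult flip: u)
  ultimately show thesis
    using that by metis
qed

lemma inverse_semigroup_univ_inv:
  "inverse_semigroup ((*) :: 'a::monoid_mult univ_inv \<Rightarrow> 'a univ_inv \<Rightarrow> 'a univ_inv)"
proof (rule mult.inverse_semigroup_if_idempotents_commute)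
  fix x :: "'a univ_inv"
  obtain u where u: "x = abs_univ_inv u"
    by (metis Quotient3_abs_rep Quotient3_univ_inv)
  have "x * abs_univ_inv (star u) * x = x"
    by (simp add: u free_inv_regular flip: abs_univ_inv_mult)
  moreover have "abs_univ_inv (star u) * x * abs_univ_inv (star u) = abs_univ_inv (star u)"
    using free_inv_regular[of "star u"] by (simp add: u flip: abs_univ_inv_mult)
  ultimately show "\<exists>y. x * y * x = x \<and> y * x * y = y"
    by blast
next
  fix e g :: "'a univ_inv"
  assume "e * e = e" "g * g = g"
  then obtain x y where x: "x * x = x" "e = abs_univ_inv x" and y: "y * y = y" "g = abs_univ_inv y"
    by (meson univ_inv_idempotent_lift)
  have "x * y = y * x"
    using free_inv_commute[of x y] x(1) y(1) by (simp add: free_inv_idempotent_eq)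
  then show "e * g = g * e"
    by (metis abs_univ_inv_mult x(2) y(2))
qed

section \<open>Generators of the quotient\<close>

definition isom :: "'a::monoid_mult \<Rightarrow> 'a univ_inv" where
  "isom p = abs_univ_inv (gen p)"

definition coisom :: "'a::monoid_mult \<Rightarrow> 'a univ_inv" where
  "coisom p = abs_univ_inv (star (gen p))"

lemma isom_mult: "isom (p * q) = isom p * isom q"
  unfolding isom_def abs_univ_inv_mult[symmetric] univ_inv.abs_eq_iff
  by (intro generated_congruence.sym[OF generated_congruence.base] univ_inv_rel.gen_mult)

lemma coisom_isom [simp]: "coisom p * isom p = 1"
proof -
  \<comment> \<open>The unit law is taken at \<open>gen 1\<close>, whose class is
    \<open>1\<close>.\<close>
  have "abs_univ_inv (star (gen p) * gen p * gen 1) = abs_univ_inv (gen 1)"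
    unfolding univ_inv.abs_eq_iff
    by (intro generated_congruence.base univ_inv_rel.unit_left)
  then show ?thesis
    by (simp add: abs_univ_inv_mult isom_def coisom_def flip: one_univ_inv.abs_eq)
qed

text \<open>Both sides are inverses of \<open>isom (p * q)\<close>, and inverses are unique.\<close>

lemma coisom_mult: "coisom (p * q) = coisom q * coisom p"
proof -
  have *: "isom r * coisom r * isom r = isom r" "coisom r * isom r * coisom r = coisom r"
    for r :: 'a
    by (simp_all add: mult.assoc)
  have "coisom q * coisom p * isom (p * q) = coisom q * (coisom p * isom p) * isom q"
    by (simp only: isom_mult mult.assoc)
  then have **: "coisom q * coisom p * isom (p * q) = 1"
    by simp
  then have "isom (p * q) * (coisom q * coisom p) * isom (p * q) = isom (p * q)"
    "coisom q * coisom p * isom (p * q) * (coisom q * coisom p) = coisom q * coisom p"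
    by (simp_all add: mult.assoc)
  with * show ?thesis
    using inverse_semigroup.ex1_inverse[OF inverse_semigroup_univ_inv, of "isom (p * q)"] by blast
qed

lemma univ_inv_induct [case_names isom coisom mult]:
  fixes x :: "'a::monoid_mult univ_inv"
  assumes isom: "\<And>p. P (isom p)" and coisom: "\<And>p. P (coisom p)"
    and mult: "\<And>x y. P x \<Longrightarrow> P y \<Longrightarrow> P (x * y)"
  shows "P x"
proof -
  \<comment> \<open>Carrying the starred term along makes the \<open>Star\<close> case a swap of the
    two conjuncts.\<close>
  have "P (abs_univ_inv (abs_free_inv t)) \<and> P (abs_univ_inv (star (abs_free_inv t)))" for t
  proof (induction t)
    case (Gen p)
    then show ?case
      using isom[of p] coisom[of p] by (simp add: isom_def coisom_def gen.abs_eq)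
  next
    case (Mul s t)
    then show ?case
      by (simp add: mult abs_univ_inv_mult free_inv_star_mult flip: times_free_inv.abs_eq)
  next
    case (Star t)
    then show ?case
      by (simp flip: star.abs_eq)
  qed
  then show ?thesis
    by (metis Quotient3_abs_rep Quotient3_univ_inv Quotient3_free_inv)
qed

section \<open>Invariant means on the quotient\<close>

lemma left_invariant_isom:
  assumes "left_invariant (*) m"
  shows "left_invariant (*) (\<lambda>\<phi>. m (\<lambda>p. \<phi> (isom p)))"
proof -
  have isom: "m (\<lambda>p. \<phi> (isom t * isom p)) = m (\<lambda>p. \<phi> (isom p))" if "\<phi> \<in> linf" for t \<phi>
    using assms linf_comp[OF that, of isom] by (force simp: left_invariant_def simp flip: isom_mult)
  have "\<forall>\<phi>\<in>linf. m (\<lambda>p. \<phi> (x * isom p)) = m (\<lambda>p. \<phi> (isom p))" for x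
  proof (induction x rule: univ_inv_induct)
    case (coisom t)
    show ?case
    proof
      fix \<phi> :: "'a univ_inv \<Rightarrow> complex" assume \<phi>: "\<phi> \<in> linf"
      from isom[OF linf_comp[OF \<phi>, of "(*) (coisom t)"], of t]
      show "m (\<lambda>p. \<phi> (coisom t * isom p)) = m (\<lambda>p. \<phi> (isom p))"
        by (simp flip: mult.assoc)
    qed
  next
    case (mult x y)
    show ?case
    proof
      fix \<phi> :: "'a univ_inv \<Rightarrow> complex" assume \<phi>: "\<phi> \<in> linf"
      show "m (\<lambda>p. \<phi> (x * y * isom p)) = m (\<lambda>p. \<phi> (isom p))"
        \<comment> \<open>The factor \<open>y\<close> next to \<open>isom p\<close> is removed
          first, with \<open>x\<close> absorbed into the function; then \<open>x\<close> is
          removed.\<close>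
        using mult(1)[rule_format, OF \<phi>] mult(2)[rule_format, OF linf_comp[OF \<phi>, of "(*) x"]]
        by (simp add: mult.assoc)
    qed
  qed (use isom in blast)
  then show ?thesis
    unfolding left_invariant_def by blast
qed

text \<open>Since \<open>coisom\<close> reverses products, left translation by \<open>t\<close>
  becomes right translation by \<open>coisom t\<close>, so a left invariant mean suffices here
  too.\<close>

lemma right_invariant_coisom:
  assumes "left_invariant (*) m"
  shows "right_invariant (*) (\<lambda>\<phi>. m (\<lambda>p. \<phi> (coisom p)))"
proof -
  have coisom: "m (\<lambda>p. \<phi> (coisom p * coisom t)) = m (\<lambda>p. \<phi> (coisom p))" if "\<phi> \<in> linf" for t \<phi>
    using assms linf_comp[OF that, of coisom]
    by (force simp: left_invariant_def simp flip: coisom_mult)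
  have "\<forall>\<phi>\<in>linf. m (\<lambda>p. \<phi> (coisom p * x)) = m (\<lambda>p. \<phi> (coisom p))" for x
  proof (induction x rule: univ_inv_induct)
    case (isom t)
    show ?case
    proof
      fix \<phi> :: "'a univ_inv \<Rightarrow> complex" assume \<phi>: "\<phi> \<in> linf"
      from coisom[OF linf_comp[OF \<phi>, of "\<lambda>x. x * isom t"], of t]
      show "m (\<lambda>p. \<phi> (coisom p * isom t)) = m (\<lambda>p. \<phi> (coisom p))"
        by (simp add: mult.assoc)
    qed
  next
    case (mult x y)
    show ?case
    proof
      fix \<phi> :: "'a univ_inv \<Rightarrow> complex" assume \<phi>: "\<phi> \<in> linf"
      show "m (\<lambda>p. \<phi> (coisom p * (x * y))) = m (\<lambda>p. \<phi> (coisom p))"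
        using mult(2)[rule_format, OF \<phi>] mult(1)[rule_format, OF linf_comp[OF \<phi>, of "\<lambda>x. x * y"]]
        by (simp add: mult.assoc)
    qed
  qed (use coisom in blast)
  then show ?thesis
    unfolding right_invariant_def by blast
qed

theorem proposition6p5:
  assumes left_cancellative: "\<And>p q r :: 'a::monoid_mult. p * q = p * r \<Longrightarrow> q = r"
    and left_amenable: "left_amenable ((*) :: 'a \<Rightarrow> 'a \<Rightarrow> 'a)"
  shows "inverse_semigroup ((*) :: 'a univ_inv \<Rightarrow> 'a univ_inv \<Rightarrow> 'a univ_inv) \<and>
    amenable ((*) :: 'a univ_inv \<Rightarrow> 'a univ_inv \<Rightarrow> 'a univ_inv)"
proof
  obtain m where m: "mean m" "left_invariant ((*) :: 'a \<Rightarrow> 'a \<Rightarrow> 'a) m"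
    using left_amenable unfolding left_amenable_def by blast
  show "amenable ((*) :: 'a univ_inv \<Rightarrow> 'a univ_inv \<Rightarrow> 'a univ_inv)"
    using mult.semigroup_axioms mean_pushforward[OF m(1)] left_invariant_isom[OF m(2)]
      mean_pushforward[OF m(1)] right_invariant_coisom[OF m(2)]
    by (rule amenable_if_left_right)
qed (rule inverse_semigroup_univ_inv)

end
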